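(* Let $\{\mathcal{M}_i\}$ be a class of models in $\Theta\subseteq\mathbb{R}^k$ with coordinate tangent cones at $0$ and distinct sets $c(\mathcal{M}_i)$ (as described in the context), and let $\mathcal{M}$ be a model in the class. Consider a sequence of parameters of the form $\theta_n=\theta_0+n^{-\gamma}h+O(n^{-2\gamma})$, with $\theta_0=0$, such that each $\theta_n\in\mathcal{M}$; here $\frac14<\gamma<\frac12$ and $h_i\ne0$ for every $i\in c(\mathcal{M})$. Suppose a consistent model selection procedure (in the sense given in the context) provides a sequence of parameter estimates $\tilde\theta_n$. Then $P(c(\tilde\theta_n)=c(\mathcal{M}))\to1$ as $n\to\infty$.
   Context: $\Theta$ is an open subset of $\mathbb{R}^k$ containing $0$. The tangent cone $C_0(\mathcal{M})$ of $\mathcal{M}\ni0$ at $0$ is the set of limits of sequences $\alpha_n\theta_n$ with $\alpha_n>0$, $\theta_n\in\mathcal{M}$, $\theta_n\to0$. Let $\Lambda_j=\langle e_j\rangle$ be the span of the $j$th coordinate vector. The class consists of regular algebraic models $\mathcal{M}_i\subseteq\Theta$ (sets defined by vanishing of finitely many polynomials, whose tangent cone at a point equals the vector space it spans) such that for each $i$ there is a set $c(\mathcal{M}_i)\subseteq\{1,\dots,k\}$ with $C_0(\mathcal{M}_i)=\bigoplus_{j\in c(\mathcal{M}_i)}\Lambda_j$, and $c(\mathcal{M}_i)\ne c(\mathcal{M}_j)$ for $i\ne j$. For a parameter $\theta\in\mathbb{R}^k$, its sparsity pattern is $c(\theta)=\{i:\theta_i\ne0\}$. The model selection procedure, given a sample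 of size $n$ from the distribution with parameter $\theta_n$, returns an estimate $\tilde\theta_n$ with sparsity pattern $\hat S=c(\tilde\theta_n)\subseteq\{1,\dots,k\}$. It is assumed consistent in the sense that for any $S\subseteq\{1,\dots,k\}$ and any sequence $\theta^n$ of true parameters with $\theta^n_{S^c}=o(n^{-1/2})$ and $|\theta^n_s|=\omega(n^{-1/2})$ for each $s\in S$, one has $P(\hat S=S)\to1$. Here $f=\omega(g)$ means $g=o(f)$. *)

theory Defs
  imports "HOL-Probability.Probability"
begin

definition algebraic_model :: "(real ^ 'k) set \<Rightarrow> (real ^ 'k) set \<Rightarrow> bool" where
  "algebraic_model \<Theta> M \<longleftrightarrow>
     (\<exists>F. finite F \<and> (\<forall>f\<in>F. real_polynomial_function f) \<and> M = {\<theta> \<in> \<Theta>. \<forall>f\<in>F. f \<theta> = 0})"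

definition tangent_cone :: "(real ^ 'k) set \<Rightarrow> real ^ 'k \<Rightarrow> (real ^ 'k) set" where
  "tangent_cone M x = {v. \<exists>(\<alpha> :: nat \<Rightarrow> real) \<theta>. (\<forall>n. \<alpha> n > 0) \<and> (\<forall>n. \<theta> n \<in> M) \<and> \<theta> \<longlonglongrightarrow> x \<and>
     (\<lambda>n. \<alpha> n *\<^sub>R (\<theta> n - x)) \<longlonglongrightarrow> v}"

definition regular_at :: "(real ^ 'k) set \<Rightarrow> real ^ 'k \<Rightarrow> bool" where
  "regular_at M x \<longleftrightarrow> x \<in> M \<and> tangent_cone M x = span (tangent_cone M x)"

definition coord_line :: "'k \<Rightarrow> (real ^ 'k) set" where
  "coord_line j = span {axis j 1}"

text \<open>In the condition on tangent cones below, the sum over \<open>c i\<close> is the Minkowski sum of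
  subspaces; it is automatically direct, since the coordinate lines are linearly independent.
  The value \<open>c i\<close> is uniquely determined by \<open>M i\<close>.\<close>

definition coordinate_model_class ::
  "(real ^ 'k) set \<Rightarrow> 'i set \<Rightarrow> ('i \<Rightarrow> (real ^ 'k) set) \<Rightarrow> ('i \<Rightarrow> 'k set) \<Rightarrow> bool" where
  "coordinate_model_class \<Theta> I M c \<longleftrightarrow>
     (\<forall>i\<in>I. algebraic_model \<Theta> (M i) \<and> regular_at (M i) 0 \<and>
        tangent_cone (M i) 0 = (\<Sum>j\<in>c i. coord_line j)) \<and>
     (\<forall>i\<in>I. \<forall>j\<in>I. i \<noteq> j \<longrightarrow> c i \<noteq> c j)"

definition sparsity_pattern :: "real ^ 'k \<Rightarrow> 'k set" where
  "sparsity_pattern \<theta> = {i. \<theta> $ i \<noteq> 0}"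

text \<open>\<open>P \<theta>\<close> is the distribution with parameter \<open>\<theta>\<close> of one observation, on the measurable
  space \<open>X\<close>.\<close>

definition statistical_model :: "(real ^ 'k) set \<Rightarrow> 'x measure \<Rightarrow> (real ^ 'k \<Rightarrow> 'x measure) \<Rightarrow> bool" where
  "statistical_model \<Theta> X P \<longleftrightarrow> (\<forall>\<theta>\<in>\<Theta>. prob_space (P \<theta>) \<and> sets (P \<theta>) = sets X)"

definition iid_sample :: "'x measure \<Rightarrow> nat \<Rightarrow> (nat \<Rightarrow> 'x) measure" where
  "iid_sample D n = (\<Pi>\<^sub>M i\<in>{..<n}. D)"

definition selection_procedure :: "'x measure \<Rightarrow> (nat \<Rightarrow> (nat \<Rightarrow> 'x) \<Rightarrow> real ^ 'k) \<Rightarrow> bool" where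
  "selection_procedure X est \<longleftrightarrow> (\<forall>n\<ge>1. est n \<in> borel_measurable (iid_sample X n))"

definition prob_selects ::
  "(real ^ 'k \<Rightarrow> 'x measure) \<Rightarrow> (nat \<Rightarrow> (nat \<Rightarrow> 'x) \<Rightarrow> real ^ 'k) \<Rightarrow> nat \<Rightarrow> real ^ 'k \<Rightarrow> 'k set \<Rightarrow> real" where
  "prob_selects P est n \<theta> S =
     measure (iid_sample (P \<theta>) n)
       {\<omega> \<in> space (iid_sample (P \<theta>) n). sparsity_pattern (est n \<omega>) = S}"

text \<open>Sample sizes start at 1, so the value of a parameter sequence at 0 is immaterial.
  The condition \<open>\<bar>\<theta>\<^sub>s\<bar> = \<omega>(n\<^sup>-\<^sup>1\<^sup>/\<^sup>2)\<close> is written in the form \<open>n\<^sup>-\<^sup>1\<^sup>/\<^sup>2 = o(\<bar>\<theta>\<^sub>s\<bar>)\<close>; all Landau symbols are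
  for \<open>n \<rightarrow> \<infinity>\<close>.\<close>

definition consistent_selection ::
  "(real ^ 'k) set \<Rightarrow> (real ^ 'k \<Rightarrow> 'x measure) \<Rightarrow> (nat \<Rightarrow> (nat \<Rightarrow> 'x) \<Rightarrow> real ^ 'k) \<Rightarrow> bool" where
  "consistent_selection \<Theta> P est \<longleftrightarrow>
     (\<forall>S \<theta>. (\<forall>n\<ge>1. \<theta> n \<in> \<Theta>) \<longrightarrow>
        (\<forall>j. j \<notin> S \<longrightarrow> (\<lambda>n. \<theta> n $ j) \<in> o(\<lambda>n. real n powr (- 1 / 2))) \<longrightarrow>
        (\<forall>s\<in>S. (\<lambda>n. real n powr (- 1 / 2)) \<in> o(\<lambda>n. \<bar>\<theta> n $ s\<bar>)) \<longrightarrow>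
        (\<lambda>n. prob_selects P est n (\<theta> n) S) \<longlonglongrightarrow> 1)"

end

theory Submission
  imports Defs
begin

text \<open>
  The hypothesis that \<open>\<theta>\<^sub>n\<close> stays in the model restricts the direction \<open>h\<close>: since
  \<open>n\<^sup>-\<^sup>2\<^sup>\<gamma> = o(n\<^sup>-\<^sup>\<gamma>)\<close>, the rescaled parameters \<open>n\<^sup>\<gamma> \<theta>\<^sub>n\<close> converge to \<open>h\<close>, so \<open>h\<close> is a tangent
  direction at the origin (\<open>tangent_cone_direction\<close>). The tangent cone is spanned by the coordinate
  lines in \<open>c m\<close>, hence \<open>h\<close> vanishes off \<open>c m\<close> (\<open>sum_coord_line_nth_eq_0\<close>).

  Off \<open>c m\<close> the coordinates of \<open>\<theta>\<^sub>n\<close> therefore consist of the remainder alone, which is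
  \<open>O(n\<^sup>-\<^sup>2\<^sup>\<gamma>) = o(n\<^sup>-\<^sup>1\<^sup>/\<^sup>2)\<close> because \<open>\<gamma> > 1/4\<close>. On \<open>c m\<close> the first-order term dominates, so these
  coordinates have exact order \<open>n\<^sup>-\<^sup>\<gamma>\<close>, which is \<open>\<omega>(n\<^sup>-\<^sup>1\<^sup>/\<^sup>2)\<close> because \<open>\<gamma> < 1/2\<close>. The exponent window
  thus separates the two kinds of coordinates at the rate \<open>n\<^sup>-\<^sup>1\<^sup>/\<^sup>2\<close>,
  and consistency applies with \<open>S = c m\<close>.
\<close>

lemma coord_line_nth_eq_0:
  fixes v :: "real ^ 'k"
  assumes "v \<in> coord_line i" and "j \<noteq> i"
  shows "v $ j = 0"
  using assms by (auto simp: coord_line_def span_singleton axis_def)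

lemma sum_coord_line_nth_eq_0:
  fixes v :: "real ^ 'k"
  assumes "v \<in> (\<Sum>i\<in>A. coord_line i)" and "j \<notin> A"
  shows "v $ j = 0"
proof -
  have "finite A"
    by simp
  then show ?thesis
    using assms
  proof (induction A arbitrary: v rule: finite_induct)
    case empty
    then show ?case
      by (simp add: set_zero)
  next
    case (insert i A)
    then obtain a b where "v = a + b" "a \<in> coord_line i" "b \<in> (\<Sum>i\<in>A. coord_line i)"
      by (auto elim: set_plus_elim)
    with insert show ?case
      by (auto simp: coord_line_nth_eq_0)
  qed
qed

text \<open>
  Dividing by \<open>a n\<close> turns the expansion \<open>x + a n h + o(a n)\<close> into one converging to \<open>h\<close>; so the
  first-order direction of a sequence in \<open>M\<close> is tangent. As the tangent cone asks
  for conditions on every index whereas asymptotics hold only eventually, the sequence is shifted.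
\<close>

lemma tangent_cone_direction:
  fixes x h :: "real ^ 'k" and \<theta> :: "nat \<Rightarrow> real ^ 'k" and a :: "nat \<Rightarrow> real"
  assumes mem: "\<forall>\<^sub>F n in sequentially. \<theta> n \<in> M"
    and pos: "\<forall>\<^sub>F n in sequentially. a n > 0"
    and null: "a \<longlonglongrightarrow> 0"
    and rem: "(\<lambda>n. norm (\<theta> n - (x + a n *\<^sub>R h))) \<in> o(a)"
  shows "h \<in> tangent_cone M x"
proof -
  obtain N where N: "\<theta> n \<in> M" "a n > 0" if "n \<ge> N" for n
    using eventually_conj[OF mem pos] by (auto simp: eventually_sequentially)
  have "(\<lambda>n. norm (\<theta> n - (x + a n *\<^sub>R h)) / a n) \<longlonglongrightarrow> 0"
    using rem by (rule smalloD_tendsto)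
  moreover have "\<forall>\<^sub>F n in sequentially. norm (\<theta> n - (x + a n *\<^sub>R h)) / a n =
      norm (inverse (a n) *\<^sub>R (\<theta> n - x) - h)"
    using pos
  proof eventually_elim
    case (elim n)
    then have "inverse (a n) *\<^sub>R (\<theta> n - x) - h = inverse (a n) *\<^sub>R (\<theta> n - (x + a n *\<^sub>R h))"
      by (simp add: algebra_simps)
    with elim show ?case
      by (simp add: divide_inverse_commute)
  qed
  ultimately have "(\<lambda>n. norm (inverse (a n) *\<^sub>R (\<theta> n - x) - h)) \<longlonglongrightarrow> 0"
    by (rule Lim_transform_eventually)
  then have scaled: "(\<lambda>n. inverse (a n) *\<^sub>R (\<theta> n - x)) \<longlonglongrightarrow> h"
    by (simp add: tendsto_norm_zero_iff LIM_zero_iff)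
  have "(\<lambda>n. a n *\<^sub>R (inverse (a n) *\<^sub>R (\<theta> n - x)) + x) \<longlonglongrightarrow> 0 *\<^sub>R h + x"
    by (intro tendsto_intros null scaled)
  moreover have "\<forall>\<^sub>F n in sequentially. a n *\<^sub>R (inverse (a n) *\<^sub>R (\<theta> n - x)) + x = \<theta> n"
    using pos by eventually_elim simp
  ultimately have lim: "\<theta> \<longlonglongrightarrow> x"
    by (auto dest: Lim_transform_eventually)
  show ?thesis
    unfolding tangent_cone_def
    using N LIMSEQ_ignore_initial_segment[OF lim, of N]
      LIMSEQ_ignore_initial_segment[OF scaled, of N]
    by (intro CollectI exI[of _ "\<lambda>n. inverse (a (n + N))"] exI[of _ "\<lambda>n. \<theta> (n + N)"]) auto
qed

lemma powr_smallo_sequentially: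
  assumes "p < (q :: real)"
  shows "(\<lambda>n. real n powr p) \<in> o(\<lambda>n. real n powr q)"
  using assms by (simp add: powr_smallo_iff filterlim_real_sequentially)

theorem theorem7p1:
  fixes \<Theta> :: "(real ^ 'k) set"
    and I :: "'i set" and M :: "'i \<Rightarrow> (real ^ 'k) set" and c :: "'i \<Rightarrow> 'k set" and m :: 'i
    and X :: "'x measure" and P :: "real ^ 'k \<Rightarrow> 'x measure"
    and est :: "nat \<Rightarrow> (nat \<Rightarrow> 'x) \<Rightarrow> real ^ 'k"
    and \<theta> :: "nat \<Rightarrow> real ^ 'k" and h :: "real ^ 'k" and \<gamma> :: real
  assumes "open \<Theta>" and "0 \<in> \<Theta>"
    and "coordinate_model_class \<Theta> I M c" and "m \<in> I"
    and "statistical_model \<Theta> X P"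
    and "selection_procedure X est"
    and "consistent_selection \<Theta> P est"
    and "1 / 4 < \<gamma>" and "\<gamma> < 1 / 2"
    and "\<forall>n\<ge>1. \<theta> n \<in> M m"
    and "(\<lambda>n. norm (\<theta> n - (0 + real n powr (- \<gamma>) *\<^sub>R h))) \<in> O(\<lambda>n. real n powr (- 2 * \<gamma>))"
    and "\<forall>i\<in>c m. h $ i \<noteq> 0"
  shows "(\<lambda>n. prob_selects P est n (\<theta> n) (c m)) \<longlonglongrightarrow> 1"
proof -
  define r where "r n = \<theta> n - (0 + real n powr (- \<gamma>) *\<^sub>R h)" for n
  have \<theta>_nth: "\<theta> n $ j = real n powr (- \<gamma>) * h $ j + r n $ j" for n j
    by (simp add: r_def)
  have r_bigo: "(\<lambda>n. norm (r n)) \<in> O(\<lambda>n. real n powr (- 2 * \<gamma>))"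
    using assms(11) unfolding r_def .
  have r_nth: "(\<lambda>n. r n $ j) \<in> O(\<lambda>n. real n powr (- 2 * \<gamma>))" for j
    by (rule landau_o.big_trans[OF _ r_bigo]) (auto intro!: bigoI[of _ 1] always_eventually
        simp: component_le_norm_cart)

  have "h \<in> tangent_cone (M m) 0"
  proof (rule tangent_cone_direction)
    show "\<forall>\<^sub>F n in sequentially. \<theta> n \<in> M m"
      using assms(10) by (auto simp: eventually_sequentially)
    show "\<forall>\<^sub>F n in sequentially. real n powr (- \<gamma>) > 0"
      using eventually_gt_at_top[of 0] by eventually_elim simp
    show "(\<lambda>n. real n powr (- \<gamma>)) \<longlonglongrightarrow> 0"
      using assms(8) by (intro tendsto_neg_powr filterlim_real_sequentially) simp
    show "(\<lambda>n. norm (\<theta> n - (0 + real n powr (- \<gamma>) *\<^sub>R h))) \<in> o(\<lambda>n. real n powr (- \<gamma>))"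
      using assms(8) by (intro landau_o.big_small_trans[OF assms(11)] powr_smallo_sequentially) simp
  qed
  then have h_off: "h $ j = 0" if "j \<notin> c m" for j
    using assms(3,4) that by (auto simp: coordinate_model_class_def intro: sum_coord_line_nth_eq_0)

  have off: "(\<lambda>n. \<theta> n $ j) \<in> o(\<lambda>n. real n powr (- 1 / 2))" if "j \<notin> c m" for j
  proof -
    have "(\<lambda>n. r n $ j) \<in> o(\<lambda>n. real n powr (- 1 / 2))"
      using assms(8) by (intro landau_o.big_small_trans[OF r_nth] powr_smallo_sequentially) simp
    with h_off[OF that] show ?thesis
      by (simp add: \<theta>_nth)
  qed

  have on: "(\<lambda>n. real n powr (- 1 / 2)) \<in> o(\<lambda>n. \<bar>\<theta> n $ j\<bar>)" if "j \<in> c m" for j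
  proof -
    have hj: "h $ j \<noteq> 0"
      using assms(12) that by blast
    have "(\<lambda>n. r n $ j) \<in> o(\<lambda>n. real n powr (- \<gamma>))"
      using assms(8) by (intro landau_o.big_small_trans[OF r_nth] powr_smallo_sequentially) simp
    with hj have "(\<lambda>n. r n $ j) \<in> o(\<lambda>n. real n powr (- \<gamma>) * h $ j)"
      by simp
    then have "o(\<lambda>n. \<theta> n $ j) = o(\<lambda>n. real n powr (- \<gamma>) * h $ j)"
      unfolding \<theta>_nth by (rule landau_o.small.plus_absorb2)
    also have "\<dots> = o(\<lambda>n. real n powr (- \<gamma>))"
      using hj by simp
    finally show ?thesis
      using powr_smallo_sequentially[of "- 1 / 2" "- \<gamma>"] assms(9) by simp
  qed

  have "\<forall>n\<ge>1. \<theta> n \<in> \<Theta>"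
    using assms(3,4,10) by (auto simp: coordinate_model_class_def algebraic_model_def)
  with off on show ?thesis
    using assms(7) unfolding consistent_selection_def by blast
qed

end
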